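(* Let $(X,d)$ be a compact metric space, let $f:X\to X$ be a continuous surjection, and let $\mathbb{F}=(f_n)_{n\in\mathbb{N}}$ be a sequence of continuous surjections $f_n:X\to X$ such that $f_n\circ f=f\circ f_n$ for every $n\in\mathbb{N}$. If $\sum_{n=1}^{\infty} D(f_n,f)<\infty$, then the proximal cell $\mathrm{Prox}_f(x)$ is dense in $X$ for every $x\in X$ if and only if the proximal cell $\mathrm{Prox}_{\mathbb{F}}(x)$ is dense in $X$ for every $x\in X$.
   Context: $D(g,h)=\sup_{x\in X}d(g(x),h(x))$ for continuous self maps $g,h$ of $X$. For $\mathbb{F}=(f_n)_{n\in\mathbb{N}}$ (with $\mathbb{N}=\{1,2,\dots\}$), put $\omega_n=f_n\circ f_{n-1}\circ\cdots\circ f_1$. A pair $(x,y)\in X\times X$ is proximal for the non-autonomous system $(X,\mathbb{F})$ if $\liminf_{n\to\infty}d(\omega_n(x),\omega_n(y))=0$, and proximal for $(X,f)$ if $\liminf_{n\to\infty}d(f^n(x),f^n(y))=0$. $\mathrm{Prox}_{\mathbb{F}}(x)=\{y\in X:(x,y)\text{ is proximal for }(X,\mathbb{F})\}$ and $\mathrm{Prox}_f(x)=\{y\in X:(x,y)\text{ is proximal for }(X,f)\}$. *)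

theory Defs
  imports "HOL-Analysis.Analysis"
begin

text \<open>The space is a set \<open>X\<close> of a metric space. Maps are total functions of which only the values
  on \<open>X\<close> matter.\<close>

definition sup_dist :: "'a::metric_space set \<Rightarrow> ('a \<Rightarrow> 'a) \<Rightarrow> ('a \<Rightarrow> 'a) \<Rightarrow> real" where
  "sup_dist X g h = (SUP x\<in>X. dist (g x) (h x))"

text \<open>Sequences of maps are indexed from 1: the value \<open>F 0\<close> is never used.\<close>

primrec omega :: "(nat \<Rightarrow> 'a \<Rightarrow> 'a) \<Rightarrow> nat \<Rightarrow> 'a \<Rightarrow> 'a" where
  "omega F 0 = id"
| "omega F (Suc n) = F (Suc n) \<circ> omega F n"

text \<open>The lower limit is taken in the extended reals, where it always exists.\<close>

definition proximal :: "('a::metric_space \<Rightarrow> 'a) \<Rightarrow> 'a \<Rightarrow> 'a \<Rightarrow> bool" where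
  "proximal f x y \<longleftrightarrow> liminf (\<lambda>n. ereal (dist ((f ^^ n) x) ((f ^^ n) y))) = 0"

definition proximal_na :: "(nat \<Rightarrow> 'a::metric_space \<Rightarrow> 'a) \<Rightarrow> 'a \<Rightarrow> 'a \<Rightarrow> bool" where
  "proximal_na F x y \<longleftrightarrow> liminf (\<lambda>n. ereal (dist (omega F n x) (omega F n y))) = 0"

definition Prox :: "'a::metric_space set \<Rightarrow> ('a \<Rightarrow> 'a) \<Rightarrow> 'a \<Rightarrow> 'a set" where
  "Prox X f x = {y \<in> X. proximal f x y}"

definition Prox_na :: "'a::metric_space set \<Rightarrow> (nat \<Rightarrow> 'a \<Rightarrow> 'a) \<Rightarrow> 'a \<Rightarrow> 'a set" where
  "Prox_na X F x = {y \<in> X. proximal_na F x y}"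

end

theory Submission imports Defs begin

text \<open>Exchanging the outermost map with \<open>f\<close> and then moving \<open>f\<close> inside by commutation shows that
  \<open>\<omega>\<^sub>n\<^sub>+\<^sub>k x\<close> and \<open>f\<^sup>k (\<omega>\<^sub>n x)\<close> differ at most by the tail \<open>\<Sum>i>n. D(f\<^sub>i, f)\<close>, uniformly in \<open>k\<close> and \<open>x\<close>.
  Since \<open>\<omega>\<^sub>n\<close> is uniformly continuous and commutes with \<open>f\<close>, it preserves \<open>f\<close>-proximality, so
  every \<open>f\<close>-proximal pair is \<open>\<F>\<close>-proximal. Conversely, the \<open>f\<close>-proximal cell of \<open>x\<close> is the
  intersection over \<open>\<epsilon>\<close> of the open sets of points that come \<open>\<epsilon>\<close>-close to the orbit of \<open>x\<close> at some time.
  Each is dense: choose \<open>n\<close> with small tail, pull \<open>x\<close> and a given open set back along the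
  surjection \<open>\<omega>\<^sub>n\<close>, find an \<open>\<F>\<close>-proximal pair there and push it forward. Baire's theorem finishes the proof.\<close>

section \<open>Lower limits, density and Baire category\<close>

lemma liminf_ereal_eq_0_iff:
  fixes a :: "nat \<Rightarrow> real"
  assumes "\<And>n. a n \<ge> 0"
  shows "liminf (\<lambda>n. ereal (a n)) = 0 \<longleftrightarrow> (\<forall>e>0. \<forall>N. \<exists>n\<ge>N. a n < e)"
proof
  assume L: "liminf (\<lambda>n. ereal (a n)) = 0"
  show "\<forall>e>0. \<forall>N. \<exists>n\<ge>N. a n < e"
  proof (rule ccontr)
    assume "\<not> ?thesis"
    then obtain e N where e: "e > 0" and N: "\<And>n. n \<ge> N \<Longrightarrow> e \<le> a n"
      by (auto simp: not_less)
    have "ereal e \<le> liminf (\<lambda>n. ereal (a n))"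
      by (rule Liminf_bounded) (auto simp: eventually_sequentially intro!: exI[of _ N] N)
    with L e show False by simp
  qed
next
  assume R: "\<forall>e>0. \<forall>N. \<exists>n\<ge>N. a n < e"
  have "0 \<le> liminf (\<lambda>n. ereal (a n))"
    by (rule Liminf_bounded) (simp add: assms)
  moreover have "\<not> 0 < liminf (\<lambda>n. ereal (a n))"
  proof
    assume "0 < liminf (\<lambda>n. ereal (a n))"
    then obtain e where e: "0 < ereal e" "ereal e < liminf (\<lambda>n. ereal (a n))"
      using ereal_dense2 by blast
    from less_LiminfD[OF e(2)] obtain N where "\<And>n. n \<ge> N \<Longrightarrow> e < a n"
      by (auto simp: eventually_sequentially)
    with R e(1) show False by (metis ereal_less(2) less_asym)
  qed
  ultimately show "liminf (\<lambda>n. ereal (a n)) = 0" by simp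
qed

lemma proximal_iff:
  "proximal f x y \<longleftrightarrow> (\<forall>e>0. \<forall>N. \<exists>n\<ge>N. dist ((f ^^ n) x) ((f ^^ n) y) < e)"
  unfolding proximal_def by (rule liminf_ereal_eq_0_iff) simp

lemma proximal_na_iff:
  "proximal_na F x y \<longleftrightarrow> (\<forall>e>0. \<forall>N. \<exists>n\<ge>N. dist (omega F n x) (omega F n y) < e)"
  unfolding proximal_na_def by (rule liminf_ereal_eq_0_iff) simp

lemma closure_eq_iff_approachable:
  fixes X :: "'a::metric_space set"
  assumes "closed X" "A \<subseteq> X"
  shows "closure A = X \<longleftrightarrow> (\<forall>u\<in>X. \<forall>e>0. \<exists>y\<in>A. dist y u < e)"
  using closure_minimal[OF assms(2,1)] by (auto simp: closure_approachable set_eq_iff)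

text \<open>A compact metric subspace is locally compact and regular, so the category theorem
  applies to \<open>top_of_set X\<close>; relative closures are then traded for closures in the
  ambient type.\<close>

lemma Baire_compact:
  fixes X :: "'a::metric_space set"
  assumes "compact X" "countable \<G>"
    and "\<And>T. T \<in> \<G> \<Longrightarrow> openin (top_of_set X) T" "\<And>T. T \<in> \<G> \<Longrightarrow> closure T = X"
  shows "X \<subseteq> closure (\<Inter>\<G>)"
proof -
  have X: "compact_space (top_of_set X)" "Hausdorff_space (top_of_set X)"
    using assms(1) by (auto intro: compact_space_subtopology Hausdorff_space_subtopology)
  then have "locally_compact_space (top_of_set X) \<and> regular_space (top_of_set X)"
    by (simp add: compact_imp_locally_compact_space compact_Hausdorff_imp_regular_space)
  moreover have "top_of_set X closure_of T = topspace (top_of_set X)" if "T \<in> \<G>" for T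
  proof -
    have "T \<subseteq> X" using assms(3)[OF that] by (rule openin_imp_subset)
    then show ?thesis
      by (simp add: closure_of_subtopology Int_absorb1 assms(4)[OF that])
  qed
  ultimately have "top_of_set X closure_of \<Inter>\<G> = topspace (top_of_set X)"
    by (intro Baire_category assms(2)) (auto intro: assms(3))
  then have "X \<inter> closure (X \<inter> \<Inter>\<G>) = X"
    by (simp add: closure_of_subtopology)
  then show ?thesis
    by (metis closure_mono inf_le2 le_iff_inf order_trans)
qed

section \<open>Compositions of maps commuting with \<open>f\<close>\<close>

lemma omega_add: "omega F (n + k) = omega (\<lambda>j. F (n + j)) k \<circ> omega F n"
  by (induction k) (simp_all add: comp_assoc)

lemma dist_le_sup_dist:
  fixes X :: "'a::metric_space set"
  assumes "compact X" "continuous_on X g" "continuous_on X h" "x \<in> X"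
  shows "dist (g x) (h x) \<le> sup_dist X g h"
  unfolding sup_dist_def
proof (rule cSUP_upper[OF assms(4)])
  have "compact ((\<lambda>x. dist (g x) (h x)) ` X)"
    by (intro compact_continuous_image continuous_intros assms)
  then show "bdd_above ((\<lambda>x. dist (g x) (h x)) ` X)"
    by (intro bounded_imp_bdd_above compact_imp_bounded)
qed

lemma funpow_image: "f ` X = X \<Longrightarrow> (f ^^ n) ` X = X"
proof (induction n)
  case (Suc n)
  then show ?case by (simp only: funpow.simps flip: image_comp)
qed simp

lemma continuous_on_funpow:
  assumes "continuous_on X f" "f ` X = X"
  shows "continuous_on X (f ^^ n)"
proof (induction n)
  case (Suc n)
  then have "continuous_on X (f \<circ> f ^^ n)"
    by (rule continuous_on_compose) (simp add: funpow_image assms)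
  then show ?case by simp
qed (simp add: id_def)

text \<open>These hypotheses pass to every shifted sequence \<open>\<lambda>j. F (n + j)\<close>,
  for which \<open>shadowing\<close> interprets the locale again.\<close>

locale commuting_surjections =
  fixes X :: "'a::metric_space set" and f :: "'a \<Rightarrow> 'a" and F :: "nat \<Rightarrow> 'a \<Rightarrow> 'a"
  assumes cpt: "compact X"
    and f_cont: "continuous_on X f" and f_surj: "f ` X = X"
    and F_cont: "\<And>n. n \<ge> 1 \<Longrightarrow> continuous_on X (F n)"
    and F_surj: "\<And>n. n \<ge> 1 \<Longrightarrow> F n ` X = X"
    and F_commute: "\<And>n x. n \<ge> 1 \<Longrightarrow> x \<in> X \<Longrightarrow> F n (f x) = f (F n x)"
begin

lemma omega_image: "omega F n ` X = X"
proof (induction n)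
  case (Suc n)
  have "F (Suc n) ` X = X" by (rule F_surj) simp
  with Suc show ?case by (simp only: omega.simps flip: image_comp)
qed simp

lemma omega_in: "x \<in> X \<Longrightarrow> omega F n x \<in> X"
  using omega_image by blast

lemma f_in: "x \<in> X \<Longrightarrow> f x \<in> X"
  using f_surj by blast

lemma funpow_in: "x \<in> X \<Longrightarrow> (f ^^ n) x \<in> X"
  using funpow_image[OF f_surj] by blast

lemma omega_continuous: "continuous_on X (omega F n)"
proof (induction n)
  case (Suc n)
  then have "continuous_on X (F (Suc n) \<circ> omega F n)"
    by (rule continuous_on_compose) (simp add: omega_image F_cont)
  then show ?case by simp
qed (simp add: id_def)

lemma omega_commute: "x \<in> X \<Longrightarrow> omega F n (f x) = f (omega F n x)"
  by (induction n) (simp_all add: F_commute omega_in)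

lemma omega_funpow_commute: "x \<in> X \<Longrightarrow> omega F n ((f ^^ k) x) = (f ^^ k) (omega F n x)"
  by (induction k) (simp_all add: omega_commute funpow_in)

lemma dist_omega_funpow_le:
  assumes "x \<in> X"
  shows "dist (omega F k x) ((f ^^ k) x) \<le> (\<Sum>i<k. sup_dist X (F (Suc i)) f)"
  using assms
proof (induction k arbitrary: x)
  case (Suc k)
  have "dist (omega F (Suc k) x) (f (omega F k x)) \<le> sup_dist X (F (Suc k)) f"
    using Suc.prems by (simp add: dist_le_sup_dist cpt F_cont f_cont omega_in)
  \<comment> \<open>The induction hypothesis is used at \<open>f x\<close>, since
    \<open>f (omega F k x) = omega F k (f x)\<close>. This way no modulus of continuity of
    \<open>f\<close> enters, and the errors simply add up.\<close>
  moreover have "dist (f (omega F k x)) ((f ^^ Suc k) x) \<le> (\<Sum>i<k. sup_dist X (F (Suc i)) f)"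
    using Suc.IH[OF f_in[OF Suc.prems]] Suc.prems by (simp add: omega_commute funpow_swap1)
  ultimately show ?case
    using dist_triangle[of "omega F (Suc k) x" "(f ^^ Suc k) x" "f (omega F k x)"] by simp
qed simp

lemma proximal_omega:
  assumes "x \<in> X" "y \<in> X" "proximal f x y"
  shows "proximal f (omega F n x) (omega F n y)"
  unfolding proximal_iff
proof (intro allI impI)
  fix e :: real and N :: nat
  assume "e > 0"
  then obtain d where "d > 0"
    and d: "\<And>u v. u \<in> X \<Longrightarrow> v \<in> X \<Longrightarrow> dist u v < d \<Longrightarrow> dist (omega F n u) (omega F n v) < e"
    using compact_uniformly_continuous[OF omega_continuous cpt]
    unfolding uniformly_continuous_on_def by metis
  from \<open>d > 0\<close> assms(3) obtain k where "k \<ge> N" "dist ((f ^^ k) x) ((f ^^ k) y) < d"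
    unfolding proximal_iff by blast
  then show "\<exists>k\<ge>N. dist ((f ^^ k) (omega F n x)) ((f ^^ k) (omega F n y)) < e"
    using d[OF funpow_in funpow_in] assms(1,2) by (metis omega_funpow_commute)
qed

lemma openin_close_orbit: "openin (top_of_set X) {y \<in> X. \<exists>k. dist ((f ^^ k) x) ((f ^^ k) y) < e}"
proof -
  have "openin (top_of_set X) (\<Union>k. X \<inter> (f ^^ k) -` ball ((f ^^ k) x) e)"
    by (intro openin_Union) (auto intro!: continuous_openin_preimage_gen continuous_on_funpow f_cont f_surj)
  moreover have "(\<Union>k. X \<inter> (f ^^ k) -` ball ((f ^^ k) x) e)
      = {y \<in> X. \<exists>k. dist ((f ^^ k) x) ((f ^^ k) y) < e}"
    by auto
  ultimately show ?thesis by simp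
qed

end

text \<open>One close time per \<open>e\<close> yields arbitrarily late ones: either the orbits meet
  by time \<open>N\<close> and agree from then on, or their distances up to \<open>N\<close> have a
  positive minimum, and getting below it takes a time after \<open>N\<close>. This is what turns the
  proximal cell into a countable intersection of open sets.\<close>

lemma proximal_if_close_orbits:
  assumes "\<And>e. e > 0 \<Longrightarrow> \<exists>k. dist ((f ^^ k) x) ((f ^^ k) y) < e"
  shows "proximal f x y"
  unfolding proximal_iff
proof (intro allI impI)
  fix e :: real and N :: nat
  assume "e > 0"
  show "\<exists>n\<ge>N. dist ((f ^^ n) x) ((f ^^ n) y) < e"
  proof (cases "\<exists>k\<le>N. (f ^^ k) x = (f ^^ k) y")
    case True
    then obtain k where k: "k \<le> N" "(f ^^ k) x = (f ^^ k) y" by blast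
    then have "(f ^^ N) x = (f ^^ N) y"
      by (metis comp_apply funpow_add le_add_diff_inverse2)
    with \<open>e > 0\<close> show ?thesis by auto
  next
    case False
    \<comment> \<open>Inserting \<open>e\<close> gives \<open>m \<le> e\<close>, so that a time
      beating \<open>m\<close> is both later than \<open>N\<close> and good enough for
      \<open>e\<close>.\<close>
    define m where "m = Min (insert e ((\<lambda>k. dist ((f ^^ k) x) ((f ^^ k) y)) ` {..N}))"
    have "m > 0"
      unfolding m_def using False \<open>e > 0\<close> by (subst Min_gr_iff) auto
    then obtain k where k: "dist ((f ^^ k) x) ((f ^^ k) y) < m"
      using assms by blast
    have "\<not> k \<le> N"
    proof
      assume "k \<le> N"
      then have "m \<le> dist ((f ^^ k) x) ((f ^^ k) y)"
        unfolding m_def by (intro Min_le) auto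
      with k show False by simp
    qed
    moreover have "m \<le> e"
      unfolding m_def by (intro Min_le) auto
    ultimately show ?thesis
      using k by (intro exI[of _ k]) auto
  qed
qed

section \<open>Shadowing and comparison of the proximal cells\<close>

locale summable_commuting_surjections = commuting_surjections +
  assumes summ: "summable (\<lambda>n. sup_dist X (F (Suc n)) f)"
begin

text \<open>After the first \<open>n\<close> maps, \<open>dist_omega_funpow_le\<close> for the
  shifted sequence bounds the error by a tail of the convergent series, whatever \<open>k\<close>
  and \<open>x\<close> are.\<close>

lemma shadowing:
  assumes "e > 0"
  obtains n where "\<And>k x. x \<in> X \<Longrightarrow> dist (omega F (n + k) x) ((f ^^ k) (omega F n x)) < e"
proof (cases "X = {}")
  \<comment> \<open>A point of \<open>X\<close> is used to see that the terms are nonnegative: a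
    real supremum over the empty set has no known sign.\<close>
  case False
  let ?D = "\<lambda>n. sup_dist X (F (Suc n)) f"
  have D: "?D n \<ge> 0" for n
  proof -
    obtain z where "z \<in> X" using False by blast
    then have "dist (F (Suc n) z) (f z) \<le> ?D n"
      by (intro dist_le_sup_dist cpt F_cont f_cont) auto
    then show ?thesis by (rule order_trans[OF zero_le_dist])
  qed
  obtain n where n: "norm (\<Sum>i. ?D (i + n)) < e"
    using suminf_exist_split[OF assms summ] by blast
  interpret shift: commuting_surjections X f "\<lambda>j. F (n + j)"
    by unfold_locales (auto simp: cpt f_cont f_surj F_cont F_surj F_commute)
  have "dist (omega F (n + k) x) ((f ^^ k) (omega F n x)) < e" if "x \<in> X" for k x
  proof -
    have "dist (omega F (n + k) x) ((f ^^ k) (omega F n x)) \<le> (\<Sum>i<k. sup_dist X (F (n + Suc i)) f)"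
      using shift.dist_omega_funpow_le[OF omega_in[OF that]] by (simp add: omega_add)
    also have "\<dots> = (\<Sum>i<k. ?D (i + n))"
      by (simp add: add.commute)
    also have "\<dots> \<le> (\<Sum>i. ?D (i + n))"
      by (rule sum_le_suminf) (auto simp: D summable_iff_shift[where f="?D"] summ)
    also have "\<dots> < e" using n by simp
    finally show ?thesis .
  qed
  then show ?thesis by (rule that)
qed (use that in auto)

lemma proximal_imp_proximal_na:
  assumes "x \<in> X" "y \<in> X" "proximal f x y"
  shows "proximal_na F x y"
  unfolding proximal_na_iff
proof (intro allI impI)
  fix e :: real and N :: nat
  assume "e > 0"
  then obtain n where n: "\<And>k x. x \<in> X \<Longrightarrow> dist (omega F (n + k) x) ((f ^^ k) (omega F n x)) < e / 3"
    using shadowing[of "e / 3"] by auto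
  \<comment> \<open>Proximality is needed for the images under \<open>omega F n\<close>, because the
    shadowing \<open>f\<close>-orbits start there. The three thirds of \<open>e\<close> are the two
    shadowing errors and this distance.\<close>
  obtain k where k: "k \<ge> N" "dist ((f ^^ k) (omega F n x)) ((f ^^ k) (omega F n y)) < e / 3"
    using proximal_omega[OF assms, of n] \<open>e > 0\<close> unfolding proximal_iff
    by (meson divide_pos_pos zero_less_numeral)
  have "dist (omega F (n + k) x) (omega F (n + k) y) < e"
    using dist_triangle_third[OF n[OF assms(1)] k(2), of "omega F (n + k) y"] n[OF assms(2), of k]
    by (simp add: dist_commute)
  with k(1) show "\<exists>n\<ge>N. dist (omega F n x) (omega F n y) < e"
    by (intro exI[of _ "n + k"]) auto
qed

text \<open>The witness is \<open>y = omega F n v\<close>, where \<open>v\<close> lies near a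
  preimage \<open>u'\<close> of \<open>u\<close> and is proximal to a preimage \<open>x'\<close> of
  \<open>x\<close> under the sequence.\<close>

lemma close_orbit_dense:
  assumes dense: "\<And>x. x \<in> X \<Longrightarrow> closure (Prox_na X F x) = X"
    and "x \<in> X" "u \<in> X" "r > 0" "e > 0"
  shows "\<exists>y\<in>X. dist y u < r \<and> (\<exists>k. dist ((f ^^ k) x) ((f ^^ k) y) < e)"
proof -
  obtain n where n: "\<And>k x. x \<in> X \<Longrightarrow> dist (omega F (n + k) x) ((f ^^ k) (omega F n x)) < e / 3"
    using shadowing[of "e / 3"] \<open>e > 0\<close> by auto
  obtain x' u' where x': "x' \<in> X" "x = omega F n x'" and u': "u' \<in> X" "u = omega F n u'"
    using \<open>x \<in> X\<close> \<open>u \<in> X\<close> omega_image[of n] by (metis imageE)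
  obtain d where "d > 0" and d: "\<And>v. v \<in> X \<Longrightarrow> dist v u' < d \<Longrightarrow> dist (omega F n v) u < r"
    using omega_continuous u' \<open>r > 0\<close> unfolding continuous_on_iff by metis
  have "u' \<in> closure (Prox_na X F x')"
    using dense x' u' by simp
  with \<open>d > 0\<close> obtain v where v: "v \<in> X" "proximal_na F x' v" "dist v u' < d"
    unfolding closure_approachable Prox_na_def by blast
  \<comment> \<open>A time \<open>m \<ge> n\<close> is chosen so that \<open>m = n + k\<close> and
    shadowing applies to both orbits.\<close>
  obtain m where m: "m \<ge> n" "dist (omega F m x') (omega F m v) < e / 3"
    using v(2) \<open>e > 0\<close> unfolding proximal_na_iff by (meson divide_pos_pos zero_less_numeral)
  define k where "k = m - n"
  with m have k: "dist (omega F (n + k) x') (omega F (n + k) v) < e / 3" by simp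
  have "dist ((f ^^ k) x) ((f ^^ k) (omega F n v)) < e"
    using dist_triangle_third[OF _ k n[OF v(1), of k], of "(f ^^ k) x"] n[OF x'(1), of k] x'(2)
    by (simp add: dist_commute)
  with d[OF v(1,3)] omega_in[OF v(1)] show ?thesis by blast
qed

text \<open>Density of the cells is assumed at all points because it is applied at preimages of
  \<open>x\<close> under \<open>omega F n\<close>, where \<open>n\<close> changes with the required
  closeness.\<close>

lemma closure_Prox_if_closure_Prox_na:
  assumes dense: "\<And>x. x \<in> X \<Longrightarrow> closure (Prox_na X F x) = X" and "x \<in> X"
  shows "closure (Prox X f x) = X"
proof
  have X: "closed X" using cpt by (rule compact_imp_closed)
  show "closure (Prox X f x) \<subseteq> X"
    by (rule closure_minimal[OF _ X]) (auto simp: Prox_def)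
  \<comment> \<open>The radii \<open>inverse (real (Suc m))\<close> are positive and tend to 0,
    which keeps the family countable for Baire's theorem.\<close>
  define A where "A m = {y \<in> X. \<exists>k. dist ((f ^^ k) x) ((f ^^ k) y) < inverse (real (Suc m))}" for m
  have "X \<subseteq> closure (\<Inter> (range A))"
  proof (rule Baire_compact[OF cpt])
    fix T assume "T \<in> range A"
    then obtain m where T: "T = A m" by blast
    show "openin (top_of_set X) T"
      unfolding T A_def by (rule openin_close_orbit)
    show "closure T = X"
    proof (subst closure_eq_iff_approachable[OF X])
      show "\<forall>u\<in>X. \<forall>r>0. \<exists>y\<in>T. dist y u < r"
      proof (intro ballI allI impI)
        fix u and r :: real
        assume "u \<in> X" "r > 0"
        then show "\<exists>y\<in>T. dist y u < r"
          using close_orbit_dense[OF dense \<open>x \<in> X\<close>, of u r "inverse (real (Suc m))"]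
          by (auto simp: T A_def)
      qed
    qed (auto simp: T A_def)
  qed auto
  also have "\<Inter> (range A) \<subseteq> Prox X f x"
  proof
    fix y assume y: "y \<in> \<Inter> (range A)"
    have "proximal f x y"
    proof (rule proximal_if_close_orbits)
      fix e :: real
      assume "e > 0"
      then obtain m where "inverse (real (Suc m)) < e"
        using reals_Archimedean by blast
      moreover from y obtain k where "dist ((f ^^ k) x) ((f ^^ k) y) < inverse (real (Suc m))"
        unfolding A_def by blast
      ultimately show "\<exists>k. dist ((f ^^ k) x) ((f ^^ k) y) < e"
        by (meson less_trans)
    qed
    with y show "y \<in> Prox X f x" by (auto simp: A_def Prox_def)
  qed
  then have "closure (\<Inter> (range A)) \<subseteq> closure (Prox X f x)" by (rule closure_mono)
  finally show "X \<subseteq> closure (Prox X f x)" .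
qed

text \<open>This direction works point by point, since the cell for \<open>f\<close> is contained in
  the cell for \<open>F\<close>.\<close>

lemma closure_Prox_na_if_closure_Prox:
  assumes "closure (Prox X f x) = X" and "x \<in> X"
  shows "closure (Prox_na X F x) = X"
proof
  show "closure (Prox_na X F x) \<subseteq> X"
    by (rule closure_minimal) (auto simp: Prox_na_def compact_imp_closed cpt)
  have "Prox X f x \<subseteq> Prox_na X F x"
    using \<open>x \<in> X\<close> proximal_imp_proximal_na by (auto simp: Prox_def Prox_na_def)
  then show "X \<subseteq> closure (Prox_na X F x)"
    using closure_mono assms(1) by blast
qed

end

theorem proposition12:
  fixes X :: "'a::metric_space set"
    and f :: "'a \<Rightarrow> 'a"
    and F :: "nat \<Rightarrow> 'a \<Rightarrow> 'a"
  assumes "compact X"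
    and "continuous_on X f" and "f ` X = X"
    and "\<And>n. n \<ge> 1 \<Longrightarrow> continuous_on X (F n)"
    and "\<And>n. n \<ge> 1 \<Longrightarrow> F n ` X = X"
    and "\<And>n x. n \<ge> 1 \<Longrightarrow> x \<in> X \<Longrightarrow> F n (f x) = f (F n x)"
    and "summable (\<lambda>n. sup_dist X (F (Suc n)) f)"
  shows "(\<forall>x\<in>X. closure (Prox X f x) = X) \<longleftrightarrow> (\<forall>x\<in>X. closure (Prox_na X F x) = X)"
proof -
  interpret summable_commuting_surjections X f F
    using assms by unfold_locales
  show ?thesis
    using closure_Prox_if_closure_Prox_na closure_Prox_na_if_closure_Prox by blast
qed

end
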